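(* Let $X,Y$ be metric spaces with $X$ complete, $F:X\times\mathbb{R}_+\rightrightarrows Y$ a set-valued mapping, $t>0$ and $(x,t,y)\in\operatorname{gph}F$. Suppose that the mapping $\tau\mapsto F_\tau^{-1}(y)$ on $\mathbb{R}_+$ is outer semicontinuous at $0$ and there are sequences of positive numbers $(b_n)_{n\ge0}$ and $(c_n)_{n\ge1}$ and a function $m:(0,\infty)\to(0,\infty)$ such that $$\sum_{n=0}^{\infty}b_n<\infty,\qquad m(\tau)\downarrow0\ \text{ as }\tau\downarrow0,\qquad c_n\downarrow0\ \text{ as } n\to\infty,$$ $$d\left(x,F_{m(c_1)}^{-1}(y)\right)<b_0,$$ $$d\left(u,F_{m(c_{n+1})}^{-1}(y)\right)<b_n\quad\text{for all } u\in F_{m(c_n)}^{-1}(y)\cap B\left(x,\sum_{i=0}^{n-1}b_i\right)\quad(n=1,2,\ldots).$$ Then $d(x,F_0^{-1}(y))<\sum_{n=0}^{\infty}b_n$.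
   Context: $\mathbb{R}_+=[0,\infty)$. $B(x,r)$ is the open ball of radius $r$ centered at $x$. $d(x,C)=\inf_{c\in C}d(x,c)$, with $d(x,\emptyset)=+\infty$. A set-valued mapping has possibly empty values; $\operatorname{gph}F=\{(x,t,y)\mid y\in F(x,t)\}$, $F_t:=F(\cdot,t):X\rightrightarrows Y$, and $F_t^{-1}(y)=\{x\in X\mid y\in F(x,t)\}$. A mapping $\Phi:\mathbb{R}_+\rightrightarrows X$ is outer semicontinuous at $\bar\tau$ if $\{z\in X\mid \liminf_{\tau\to\bar\tau,\,\tau\in\mathbb{R}_+}d(z,\Phi(\tau))=0\}\subset\Phi(\bar\tau)$. The notation $\downarrow0$ means convergence to $0$ through positive values. *)

theory Defs
  imports "HOL-Analysis.Analysis"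
begin

(* The infimum is taken in ereal so that pdist x {} = \<infinity>; infdist and setdist are 0 there. *)
definition pdist :: "'a::metric_space \<Rightarrow> 'a set \<Rightarrow> ereal" where
  "pdist x C = (INF c\<in>C. ereal (dist x c))"

(* A set-valued mapping on X \<times> [0,\<infinity>) is a function into sets whose values at t < 0 are ignored. *)
definition gph :: "('a \<Rightarrow> real \<Rightarrow> 'b set) \<Rightarrow> ('a \<times> real \<times> 'b) set" where
  "gph F = {(x, t, y). 0 \<le> t \<and> y \<in> F x t}"

(* slice_inv F t y is F_t^{-1}(y), where F_t = F(.,t). *)
definition slice_inv :: "('a \<Rightarrow> real \<Rightarrow> 'b set) \<Rightarrow> real \<Rightarrow> 'b \<Rightarrow> 'a set" where
  "slice_inv F t y = {x. y \<in> F x t}"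

(* The lower limit does not see the value at \<tau>0 itself. Admitting \<tau> = \<tau>0 could only
   decrease the lower limit and so would give a more restrictive notion, namely this
   one together with closedness of \<Phi> \<tau>0. *)
definition outer_semicontinuous_at :: "(real \<Rightarrow> 'a::metric_space set) \<Rightarrow> real \<Rightarrow> bool" where
  "outer_semicontinuous_at \<Phi> \<tau>0 \<longleftrightarrow>
     {z. Liminf (at \<tau>0 within {0..}) (\<lambda>\<tau>. pdist z (\<Phi> \<tau>)) = 0} \<subseteq> \<Phi> \<tau>0"

end

theory Submission
  imports Defs
begin

text \<open>
  The proof is an iteration in the style of Lyusternik and Graves. Write \<open>\<Phi> \<tau>\<close> for the fibre
  \<open>slice_inv F \<tau> y\<close>. Starting from \<open>u 0 = x\<close>, the distance hypotheses let one pick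
  points \<open>u n \<in> \<Phi> (m (c n))\<close> for \<open>n \<ge> 1\<close> such that the \<open>n\<close>-th step, from \<open>u n\<close> to \<open>u (Suc n)\<close>, is shorter than
  \<open>b n\<close>; by the triangle inequality \<open>u n\<close> then stays in the ball in which the next step is
  permitted (\<open>exists_chain_with_short_steps\<close>). As \<open>b\<close> is summable and the space is complete,
  the chain converges to a point \<open>z\<close>, at distance less than \<open>\<Sum>n. b n\<close> from \<open>x\<close>
  (\<open>convergent_of_short_steps\<close>). Since the parameters \<open>m (c n)\<close> tend to \<open>0\<close> through positive
  values and \<open>u n\<close> tends to \<open>z\<close>, the lower limit of the distances from \<open>z\<close> to the fibres is
  \<open>0\<close>, so outer semicontinuity puts \<open>z\<close> in \<open>\<Phi> 0\<close> (\<open>outer_semicontinuous_at_sequentially\<close>).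
\<close>

lemma pdist_nonneg: "0 \<le> pdist x C"
  unfolding pdist_def by (rule INF_greatest) simp

lemma pdist_le_dist: "c \<in> C \<Longrightarrow> pdist x C \<le> ereal (dist x c)"
  unfolding pdist_def by (rule INF_lower)

lemma pdist_less_iff: "pdist x C < ereal r \<longleftrightarrow> (\<exists>c\<in>C. dist x c < r)"
  unfolding pdist_def by (simp add: INF_less_iff)

lemma dist_le_sum_steps:
  fixes u :: "nat \<Rightarrow> 'a::metric_space"
  assumes "k \<le> n"
  shows "dist (u k) (u n) \<le> (\<Sum>i=k..<n. dist (u i) (u (Suc i)))"
  using assms
proof (induction n rule: dec_induct)
  case (step n)
  have "dist (u k) (u (Suc n)) \<le> dist (u k) (u n) + dist (u n) (u (Suc n))"
    by (rule dist_triangle)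
  with step show ?case by simp
qed simp

text \<open>The strict inequality survives the passage to the limit because \<open>dist (u 0) z\<close> is bounded
  by the sum of the actual step lengths, each of which is below its bound.\<close>

lemma convergent_of_short_steps:
  fixes u :: "nat \<Rightarrow> 'a::complete_space"
  assumes short: "\<And>n. dist (u n) (u (Suc n)) < b n" and "summable b"
  obtains z where "u \<longlonglongrightarrow> z" and "dist (u 0) z < (\<Sum>n. b n)"
proof -
  define d where "d n = dist (u n) (u (Suc n))" for n
  have d: "summable d"
    by (rule summable_comparison_test'[OF \<open>summable b\<close>, of 0])
       (use short in \<open>auto simp: d_def less_imp_le\<close>)
  have "Cauchy u"
  proof (rule metric_CauchyI)
    fix e :: real assume "e > 0"
    with d obtain N where N: "\<And>k n. k \<ge> N \<Longrightarrow> norm (sum d {k..<n}) < e"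
      unfolding summable_Cauchy by blast
    have *: "dist (u k) (u n) < e" if "N \<le> k" "k \<le> n" for k n
      using dist_le_sum_steps[of k n u] N[of k n] that by (simp add: d_def)
    show "\<exists>N. \<forall>k\<ge>N. \<forall>n\<ge>N. dist (u k) (u n) < e"
    proof (intro exI allI impI)
      fix k n assume "N \<le> k" "N \<le> n"
      then show "dist (u k) (u n) < e"
        using *[of k n] *[of n k] by (cases "k \<le> n") (simp_all add: dist_commute)
    qed
  qed
  then obtain z where z: "u \<longlonglongrightarrow> z"
    using Cauchy_convergent convergent_def by blast
  have "dist (u 0) z \<le> (\<Sum>n. d n)"
  proof (rule LIMSEQ_le_const2[OF tendsto_dist[OF tendsto_const z]], intro exI allI impI)
    fix n
    have "dist (u 0) (u n) \<le> (\<Sum>i<n. d i)"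
      using dist_le_sum_steps[of 0 n u] by (simp add: d_def atLeast0LessThan)
    also have "\<dots> \<le> (\<Sum>n. d n)"
      by (rule sum_le_suminf[OF d]) (auto simp: d_def)
    finally show "dist (u 0) (u n) \<le> (\<Sum>n. d n)" .
  qed
  also have "(\<Sum>n. d n) < (\<Sum>n. b n)"
  proof -
    have "0 < (\<Sum>n. b n - d n)"
      by (rule suminf_pos[OF summable_diff[OF \<open>summable b\<close> d]])
         (use short in \<open>simp add: d_def\<close>)
    then show ?thesis
      using suminf_diff[OF \<open>summable b\<close> d] by simp
  qed
  finally show ?thesis using z that by blast
qed

text \<open>The hypothesis on the \<open>n\<close>-th set is only available inside a ball of radius
  \<open>\<Sum>i<n. b i\<close>, which is exactly the bound that the first \<open>n\<close> steps put on the distance from \<open>x\<close>;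
  so the choice has to carry the membership in this ball along.\<close>

lemma exists_chain_with_short_steps:
  fixes A :: "nat \<Rightarrow> 'a::metric_space set"
  assumes first: "pdist x (A 1) < ereal (b 0)"
    and nxt: "\<And>n u. n \<ge> 1 \<Longrightarrow> u \<in> A n \<inter> ball x (\<Sum>i<n. b i) \<Longrightarrow>
                pdist u (A (Suc n)) < ereal (b n)"
  obtains u where "u 0 = x" and "\<And>n. n \<ge> 1 \<Longrightarrow> u n \<in> A n"
    and "\<And>n. dist (u n) (u (Suc n)) < b n"
proof -
  \<comment> \<open>For \<open>n = 0\<close> the ball has radius \<open>0\<close> and is empty, so the start \<open>x\<close> is a separate case.\<close>
  define P where "P n v \<longleftrightarrow> (if n = 0 then v = x else v \<in> A n \<inter> ball x (\<Sum>i<n. b i))" for n v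
  have "\<exists>u. \<forall>n. P n (u n) \<and> dist (u n) (u (Suc n)) < b n"
  proof (rule dependent_nat_choice)
    show "\<exists>v. P 0 v" by (simp add: P_def)
  next
    fix v n assume v: "P n v"
    have le: "dist x v \<le> (\<Sum>i<n. b i)"
      using v by (cases "n = 0") (auto simp: P_def)
    have "pdist v (A (Suc n)) < ereal (b n)"
      using v first nxt[of n v] by (cases "n = 0") (auto simp: P_def)
    then obtain w where w: "w \<in> A (Suc n)" "dist v w < b n"
      by (auto simp: pdist_less_iff)
    have "dist x w < (\<Sum>i<Suc n. b i)"
      using le w(2) dist_triangle[of x w v] by simp
    with w show "\<exists>w. P (Suc n) w \<and> dist v w < b n"
      by (auto simp: P_def simp del: sum.lessThan_Suc)
  qed
  then obtain u where u: "\<And>n. P n (u n)" "\<And>n. dist (u n) (u (Suc n)) < b n"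
    by blast
  show ?thesis
  proof (rule that)
    show "u 0 = x" using u(1)[of 0] by (simp add: P_def)
    show "u n \<in> A n" if "n \<ge> 1" for n using u(1)[of n] that by (simp add: P_def)
  qed (rule u(2))
qed

text \<open>Outer semicontinuity speaks of a lower limit over all parameters. Along \<open>s\<close> the distance
  from \<open>z\<close> to \<open>\<Phi> (s n)\<close> is at most \<open>dist z (u n)\<close>, which tends to \<open>0\<close>, and this already
  forces the lower limit down to \<open>0\<close>.\<close>

lemma outer_semicontinuous_at_sequentially:
  assumes osc: "outer_semicontinuous_at \<Phi> \<tau>0"
    and s: "filterlim s (at \<tau>0 within {0..}) sequentially"
    and u: "u \<longlonglongrightarrow> z" and mem: "eventually (\<lambda>n. u n \<in> \<Phi> (s n)) sequentially"
  shows "z \<in> \<Phi> \<tau>0"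
proof -
  let ?F = "at \<tau>0 within {0..}"
  have "Liminf ?F (\<lambda>\<tau>. pdist z (\<Phi> \<tau>)) \<le> 0"
  proof (rule ccontr)
    assume "\<not> ?thesis"
    then have "0 < Liminf ?F (\<lambda>\<tau>. pdist z (\<Phi> \<tau>))" by (simp only: not_le)
    from ereal_dense2[OF this] obtain e
      where "0 < ereal e" and e: "ereal e < Liminf ?F (\<lambda>\<tau>. pdist z (\<Phi> \<tau>))" by blast
    have "eventually (\<lambda>\<tau>. ereal e < pdist z (\<Phi> \<tau>)) ?F"
      using e by (rule less_LiminfD)
    then have "eventually (\<lambda>n. ereal e < pdist z (\<Phi> (s n))) sequentially"
      using s by (rule eventually_compose_filterlim)
    moreover have "eventually (\<lambda>n. dist (u n) z < e) sequentially"
      using tendstoD[OF u] \<open>0 < ereal e\<close> by simp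
    ultimately have "eventually (\<lambda>_. False) sequentially"
      using mem
    proof eventually_elim
      case (elim n)
      have "pdist z (\<Phi> (s n)) \<le> ereal (dist z (u n))"
        using elim by (intro pdist_le_dist)
      also have "\<dots> < ereal e" using elim by (simp add: dist_commute)
      finally show ?case using elim by simp
    qed
    then show False by simp
  qed
  moreover have "0 \<le> Liminf ?F (\<lambda>\<tau>. pdist z (\<Phi> \<tau>))"
    by (intro Liminf_bounded always_eventually allI pdist_nonneg)
  ultimately show ?thesis
    using osc unfolding outer_semicontinuous_at_def by (auto intro: antisym)
qed

theorem theorem2p3:
  fixes F :: "'a::complete_space \<Rightarrow> real \<Rightarrow> 'b::metric_space set"
    and x :: 'a and t :: real and y :: 'b
    and b c :: "nat \<Rightarrow> real" and m :: "real \<Rightarrow> real"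
  assumes "t > 0" and "(x, t, y) \<in> gph F"
    and "outer_semicontinuous_at (\<lambda>\<tau>. slice_inv F \<tau> y) 0"
    and "\<And>n. b n > 0" and "\<And>n. n \<ge> 1 \<Longrightarrow> c n > 0"
    and "\<And>\<tau>. \<tau> > 0 \<Longrightarrow> m \<tau> > 0"
    and "summable b"
    and "filterlim m (at_right 0) (at_right 0)"
    and "filterlim c (at_right 0) sequentially"
    and "pdist x (slice_inv F (m (c 1)) y) < ereal (b 0)"
    and "\<And>n u. n \<ge> 1 \<Longrightarrow> u \<in> slice_inv F (m (c n)) y \<inter> ball x (\<Sum>i<n. b i) \<Longrightarrow>
           pdist u (slice_inv F (m (c (n + 1))) y) < ereal (b n)"
  shows "pdist x (slice_inv F 0 y) < ereal (\<Sum>n. b n)"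
proof -
  obtain u where u: "u 0 = x" "\<And>n. n \<ge> 1 \<Longrightarrow> u n \<in> slice_inv F (m (c n)) y"
      "\<And>n. dist (u n) (u (Suc n)) < b n"
    using exists_chain_with_short_steps[of x "\<lambda>n. slice_inv F (m (c n)) y" b] assms(10,11)
    by auto
  obtain z where z: "u \<longlonglongrightarrow> z" "dist x z < (\<Sum>n. b n)"
    using convergent_of_short_steps[OF u(3) \<open>summable b\<close>] u(1) by auto
  have "filterlim (\<lambda>n. m (c n)) (at_right 0) sequentially"
    using assms(8,9) by (rule filterlim_compose)
  then have "filterlim (\<lambda>n. m (c n)) (at 0 within {0..}) sequentially"
    by (rule filterlim_mono) (auto intro: at_le)
  moreover have "eventually (\<lambda>n. u n \<in> slice_inv F (m (c n)) y) sequentially"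
    using eventually_ge_at_top[of 1] by (rule eventually_mono) (rule u(2))
  ultimately have "z \<in> slice_inv F 0 y"
    using assms(3) z(1) by (intro outer_semicontinuous_at_sequentially)
  with z(2) show ?thesis
    by (auto simp: pdist_less_iff)
qed

end
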